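(* Let $X$ be a Banach space having the M-(FPP for affine isometries), i.e. every spreading model of $X$ has the fixed point property for affine isometries. Then $X$ has the Banach-Saks property.
   Context: Banach spaces are real. Spreading models: a sequence $(x_n)_n$ in $X$ is good if for all $k\in\mathbb N$ and $a_1,\dots,a_k\in\mathbb R$ the limit $\lim_{n_1\to\infty}\|a_1x_{n_1}+\dots+a_kx_{n_k}\|$ (over $n_1<\dots<n_k$) exists. If $(x_n)_n$ is a bounded good sequence that is not convergent, then $\|(a_1,\dots,a_k)\|=\lim_{n_1\to\infty}\|a_1x_{n_1}+\dots+a_kx_{n_k}\|$ ($n_1<\dots<n_k$) defines a norm on $c_{00}$, and the completion $Z$ of $c_{00}$ for this norm is called the spreading model of $X$ built on $(x_n)_n$. Fixed point property: a Banach space $Z$ has the FPP for affine isometries if for every nonempty closed convex bounded subset $D\subset Z$, every affine isometry $D\to D$ (distance-preserving, not necessarily surjective) has a fixed point. Banach-Saks property: $X$ has it if every bounded sequence $(x_n)_n\subset X$ admits a subsequence $(x_{\phi(n)})_n$ such that $\left(\frac1n\sum_{k=1}^n x_{\phi(k)}\right)_n$ converges in norm. *)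

theory Defs
  imports "HOL-Analysis.Analysis" "HOL-Analysis.Finite_Function_Topology"
begin

text \<open>
  The spreading models of a Banach space depend on a sequence of vectors, so they cannot be types.
  Real normed spaces that arise this way are given by an explicit carrier with operations, which
  are only meaningful on the carrier.
\<close>

record 'z nspace =
  ns_carrier :: "'z set"
  ns_add :: "'z \<Rightarrow> 'z \<Rightarrow> 'z"
  ns_scale :: "real \<Rightarrow> 'z \<Rightarrow> 'z"
  ns_norm :: "'z \<Rightarrow> real"

text \<open>The locale \<^locale>\<open>Metric_space\<close> requires symmetry and nonnegativity on the whole type;
  this is why the distance is set to 0 off the carrier.\<close>

definition ns_dist :: "'z nspace \<Rightarrow> 'z \<Rightarrow> 'z \<Rightarrow> real" where
  "ns_dist Z u v =
     (if u \<in> ns_carrier Z \<and> v \<in> ns_carrier Z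
      then ns_norm Z (ns_add Z u (ns_scale Z (-1) v)) else 0)"

definition ns_comb :: "'z nspace \<Rightarrow> real \<Rightarrow> 'z \<Rightarrow> 'z \<Rightarrow> 'z" where
  "ns_comb Z t u v = ns_add Z (ns_scale Z (1 - t) u) (ns_scale Z t v)"

definition ns_closed :: "'z nspace \<Rightarrow> 'z set \<Rightarrow> bool" where
  "ns_closed Z D \<longleftrightarrow> closedin (Metric_space.mtopology (ns_carrier Z) (ns_dist Z)) D"

definition ns_convex :: "'z nspace \<Rightarrow> 'z set \<Rightarrow> bool" where
  "ns_convex Z D \<longleftrightarrow> (\<forall>u\<in>D. \<forall>v\<in>D. \<forall>t\<in>{0..1}. ns_comb Z t u v \<in> D)"

definition ns_bounded :: "'z nspace \<Rightarrow> 'z set \<Rightarrow> bool" where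
  "ns_bounded Z D \<longleftrightarrow> (\<exists>B. \<forall>u\<in>D. ns_norm Z u \<le> B)"

definition affine_isometry_on :: "'z nspace \<Rightarrow> 'z set \<Rightarrow> ('z \<Rightarrow> 'z) \<Rightarrow> bool" where
  "affine_isometry_on Z D T \<longleftrightarrow>
     T \<in> D \<rightarrow> D \<and>
     (\<forall>u\<in>D. \<forall>v\<in>D. ns_dist Z (T u) (T v) = ns_dist Z u v) \<and>
     (\<forall>u\<in>D. \<forall>v\<in>D. \<forall>t\<in>{0..1}. T (ns_comb Z t u v) = ns_comb Z t (T u) (T v))"

definition fpp_affine_isometries :: "'z nspace \<Rightarrow> bool" where
  "fpp_affine_isometries Z \<longleftrightarrow>
     (\<forall>D T. D \<subseteq> ns_carrier Z \<and> D \<noteq> {} \<and> ns_closed Z D \<and> ns_convex Z D \<and> ns_bounded Z D \<and>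
            affine_isometry_on Z D T
        \<longrightarrow> (\<exists>z\<in>D. T z = z))"

text \<open>
  The completion of a real vector space for a norm \<open>p\<close> (which need not be the norm, if any, that
  the type class system provides): Cauchy sequences modulo null sequences.
\<close>

definition Cauchy_seqs :: "('v::real_vector \<Rightarrow> real) \<Rightarrow> (nat \<Rightarrow> 'v) set" where
  "Cauchy_seqs p = {u. \<forall>e>0. \<exists>M. \<forall>m\<ge>M. \<forall>n\<ge>M. p (u m - u n) < e}"

definition null_rel :: "('v::real_vector \<Rightarrow> real) \<Rightarrow> ((nat \<Rightarrow> 'v) \<times> (nat \<Rightarrow> 'v)) set" where
  "null_rel p = {(u, v). u \<in> Cauchy_seqs p \<and> v \<in> Cauchy_seqs p \<and> (\<lambda>n. p (u n - v n)) \<longlonglongrightarrow> 0}"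

definition ns_completion :: "('v::real_vector \<Rightarrow> real) \<Rightarrow> (nat \<Rightarrow> 'v) set nspace" where
  "ns_completion p =
     \<lparr>ns_carrier = Cauchy_seqs p // null_rel p,
      ns_add = (\<lambda>U V. \<Union>u\<in>U. \<Union>v\<in>V. null_rel p `` {\<lambda>n. u n + v n}),
      ns_scale = (\<lambda>c U. \<Union>u\<in>U. null_rel p `` {\<lambda>n. c *\<^sub>R u n}),
      ns_norm = (\<lambda>U. the_elem ((\<lambda>u. lim (\<lambda>n. p (u n))) ` U))\<rparr>"

text \<open>
  Indices start at 0. The limit as \<open>n\<^sub>1 \<rightarrow> \<infinity>\<close> over \<open>n\<^sub>1 < \<dots> < n\<^sub>k\<close> is taken along the following
  filter, whose members are strictly increasing infinite sequences of indices: every increasing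
  tuple is an initial segment of one of these, and only finitely many of their entries are used.
\<close>

definition spread_filter :: "(nat \<Rightarrow> nat) filter" where
  "spread_filter = inf (filtercomap (\<lambda>n. n 0) at_top) (principal {n. strict_mono n})"

definition good_seq :: "(nat \<Rightarrow> 'a::real_normed_vector) \<Rightarrow> bool" where
  "good_seq x \<longleftrightarrow>
     (\<forall>k. \<forall>a :: nat \<Rightarrow> real. \<exists>l. ((\<lambda>n. norm (\<Sum>i<k. a i *\<^sub>R x (n i))) \<longlongrightarrow> l) spread_filter)"

text \<open>The space \<open>c\<^sub>0\<^sub>0\<close> is the type of finitely supported real sequences.\<close>

definition spreading_norm :: "(nat \<Rightarrow> 'a::real_normed_vector) \<Rightarrow> (nat \<Rightarrow>\<^sub>0 real) \<Rightarrow> real" where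
  "spreading_norm x a =
     Lim spread_filter (\<lambda>n. norm (\<Sum>i\<in>Poly_Mapping.keys a. Poly_Mapping.lookup a i *\<^sub>R x (n i)))"

definition spreading_models ::
    "'a::real_normed_vector itself \<Rightarrow> (nat \<Rightarrow> (nat \<Rightarrow>\<^sub>0 real)) set nspace set" where
  "spreading_models _ =
     {ns_completion (spreading_norm x) | x :: nat \<Rightarrow> 'a.
        bounded (range x) \<and> good_seq x \<and> \<not> convergent x}"

definition Banach_Saks :: "'a::real_normed_vector itself \<Rightarrow> bool" where
  "Banach_Saks _ \<longleftrightarrow>
     (\<forall>x :: nat \<Rightarrow> 'a. bounded (range x) \<longrightarrow>
        (\<exists>\<phi> :: nat \<Rightarrow> nat. strict_mono \<phi> \<and>
           convergent (\<lambda>n. (1 / real n) *\<^sub>R (\<Sum>k<n. x (\<phi> k)))))"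

end

(* A bounded sequence has a good subsequence x; if x converges, so do its Cesaro means. Otherwise let
   D be the closed convex hull of the unit vectors in the spreading model of x. The right shift maps
   D isometrically and affinely into itself, so it fixes some z in D. A convex combination c of unit
   vectors close to z is close to all of its shifts. In terms of x this says that the combinations
   sum_i c_i x_(k+i) are, for large k, all close to one vector; their averages over k < n differ from
   the Cesaro means of x by a null sequence, so these means form a Cauchy sequence. *)

theory Submission
  imports Defs "HOL-Library.Ramsey" "HOL-Library.Diagonal_Subsequence"
begin

section \<open>Completions of seminormed spaces\<close>

text \<open>The fixed point is a class of Cauchy sequences in c_00 and need not be a combination of
  terms of x. Information returns to X only through finitely supported vectors, whose spreading norm
  is a limit of norms in X; this is why the fixed point has to be replaced by an approximant c.
  Nothing is lost with the number of shifts: the shift is isometric and fixes z, so every iterate of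
  c is exactly as far from z as c is. The completion is built from a seminorm. Identifying sequences
  whose difference is null makes distinct classes have positive distance, so the axioms to be
  checked for a spreading norm are those that pass to limits: the triangle inequality and
  homogeneity. The vector approached by the combinations depends on the precision. It is therefore
  not a candidate for the limit of the means, and completeness of X supplies that limit.\<close>

locale real_seminorm =
  fixes p :: "'v::real_vector \<Rightarrow> real"
  assumes p_add: "p (u + v) \<le> p u + p v"
    and p_scale: "p (c *\<^sub>R u) = \<bar>c\<bar> * p u"
begin

lemma p_zero [simp]: "p 0 = 0"
  using p_scale[of 0 0] by simp

lemma p_minus: "p (- u) = p u"
  using p_scale[of "-1" u] by simp

lemma p_diff_commute: "p (u - v) = p (v - u)"
  using p_minus[of "u - v"] by simp

lemma p_nonneg [simp]: "0 \<le> p u"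
  using p_add[of u "- u"] by (simp add: p_minus)

lemma p_abs_diff_le: "\<bar>p u - p v\<bar> \<le> p (u - v)"
  using p_add[of "u - v" v] p_add[of "v - u" u] by (simp add: p_diff_commute[of v u])

section \<open>Cauchy sequences and the limit of their seminorms\<close>

lemma Cauchy_seqs_const [simp]: "(\<lambda>n. c) \<in> Cauchy_seqs p"
  by (simp add: Cauchy_seqs_def)

lemma Cauchy_seqs_image:
  assumes u: "u \<in> Cauchy_seqs p" and S: "\<And>v w. p (S v - S w) \<le> p (v - w)"
  shows "(\<lambda>n. S (u n)) \<in> Cauchy_seqs p"
  using u le_less_trans[OF S] unfolding Cauchy_seqs_def mem_Collect_eq by meson

lemma Cauchy_seqs_add:
  assumes "u \<in> Cauchy_seqs p" "v \<in> Cauchy_seqs p"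
  shows "(\<lambda>n. u n + v n) \<in> Cauchy_seqs p"
  unfolding Cauchy_seqs_def
proof (intro CollectI allI impI)
  fix e :: real assume "e > 0"
  then have "e/2 > 0" by simp
  then obtain M M' where M: "\<forall>m\<ge>M. \<forall>n\<ge>M. p (u m - u n) < e/2" "\<forall>m\<ge>M'. \<forall>n\<ge>M'. p (v m - v n) < e/2"
    using assms unfolding Cauchy_seqs_def by blast
  have "p (u m + v m - (u n + v n)) < e" if "m \<ge> max M M'" "n \<ge> max M M'" for m n
    using p_add[of "u m - u n" "v m - v n"] M(1)[rule_format, of m n] M(2)[rule_format, of m n] that
    by (simp add: algebra_simps)
  then show "\<exists>M. \<forall>m\<ge>M. \<forall>n\<ge>M. p (u m + v m - (u n + v n)) < e" by blast
qed

lemma Cauchy_seqs_scale: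
  assumes "u \<in> Cauchy_seqs p"
  shows "(\<lambda>n. c *\<^sub>R u n) \<in> Cauchy_seqs p"
  unfolding Cauchy_seqs_def
proof (intro CollectI allI impI)
  fix e :: real assume "e > 0"
  then have "e / (\<bar>c\<bar> + 1) > 0" by simp
  then obtain M where M: "\<forall>m\<ge>M. \<forall>n\<ge>M. p (u m - u n) < e / (\<bar>c\<bar> + 1)"
    using assms unfolding Cauchy_seqs_def by blast
  have "p (c *\<^sub>R u m - c *\<^sub>R u n) < e" if "m \<ge> M" "n \<ge> M" for m n
  proof -
    have "p (c *\<^sub>R u m - c *\<^sub>R u n) = \<bar>c\<bar> * p (u m - u n)"
      by (simp add: p_scale flip: scaleR_diff_right)
    also have "\<dots> \<le> (\<bar>c\<bar> + 1) * p (u m - u n)" by (simp add: mult_right_mono)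
    also have "\<dots> < e"
      using M[rule_format, OF that] pos_less_divide_eq[of "\<bar>c\<bar> + 1"] by (simp add: mult.commute)
    finally show ?thesis .
  qed
  then show "\<exists>M. \<forall>m\<ge>M. \<forall>n\<ge>M. p (c *\<^sub>R u m - c *\<^sub>R u n) < e" by blast
qed

lemma Cauchy_seqs_diff:
  assumes "u \<in> Cauchy_seqs p" "v \<in> Cauchy_seqs p"
  shows "(\<lambda>n. u n - v n) \<in> Cauchy_seqs p"
  using Cauchy_seqs_add[OF assms(1) Cauchy_seqs_scale[OF assms(2), of "-1"]] by simp

text \<open>The seminorm on Cauchy sequences whose kernel is divided out in the completion. Norms,
  distances and equality of classes are all computed with it on representatives.\<close>

definition lim_norm :: "(nat \<Rightarrow> 'v) \<Rightarrow> real" where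
  "lim_norm u = lim (\<lambda>n. p (u n))"

lemma tendsto_lim_norm:
  assumes "u \<in> Cauchy_seqs p"
  shows "(\<lambda>n. p (u n)) \<longlonglongrightarrow> lim_norm u"
proof -
  have "Cauchy (\<lambda>n. p (u n))"
    unfolding Cauchy_def dist_real_def
    using assms le_less_trans[OF p_abs_diff_le] unfolding Cauchy_seqs_def mem_Collect_eq by meson
  then show ?thesis
    by (simp add: lim_norm_def Cauchy_convergent_iff convergent_LIMSEQ_iff)
qed

lemma lim_norm_eqI: "(\<lambda>n. p (u n)) \<longlonglongrightarrow> l \<Longrightarrow> lim_norm u = l"
  by (simp add: lim_norm_def limI)

lemma lim_norm_const [simp]: "lim_norm (\<lambda>n. c) = p c"
  by (simp add: lim_norm_eqI)

lemma lim_norm_nonneg: "u \<in> Cauchy_seqs p \<Longrightarrow> 0 \<le> lim_norm u"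
  by (rule LIMSEQ_le_const[OF tendsto_lim_norm]) auto

lemma lim_norm_add:
  assumes "u \<in> Cauchy_seqs p" "v \<in> Cauchy_seqs p"
  shows "lim_norm (\<lambda>n. u n + v n) \<le> lim_norm u + lim_norm v"
  by (rule LIMSEQ_le[OF tendsto_lim_norm tendsto_add[OF tendsto_lim_norm tendsto_lim_norm]])
     (auto simp: assms Cauchy_seqs_add p_add)

lemma lim_norm_scale:
  assumes "u \<in> Cauchy_seqs p"
  shows "lim_norm (\<lambda>n. c *\<^sub>R u n) = \<bar>c\<bar> * lim_norm u"
  by (rule lim_norm_eqI) (simp add: p_scale tendsto_lim_norm[OF assms] tendsto_mult_left)

lemma lim_norm_diff_commute: "lim_norm (\<lambda>n. u n - v n) = lim_norm (\<lambda>n. v n - u n)"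
  by (simp add: lim_norm_def p_diff_commute)

lemma lim_norm_diff_triangle:
  assumes "u \<in> Cauchy_seqs p" "v \<in> Cauchy_seqs p" "w \<in> Cauchy_seqs p"
  shows "lim_norm (\<lambda>n. u n - w n) \<le> lim_norm (\<lambda>n. u n - v n) + lim_norm (\<lambda>n. v n - w n)"
  using lim_norm_add[of "\<lambda>n. u n - v n" "\<lambda>n. v n - w n"] assms by (simp add: Cauchy_seqs_diff)

section \<open>The quotient by null sequences\<close>

lemma null_rel_iff:
  "(u, v) \<in> null_rel p \<longleftrightarrow>
     u \<in> Cauchy_seqs p \<and> v \<in> Cauchy_seqs p \<and> lim_norm (\<lambda>n. u n - v n) = 0"
  using tendsto_lim_norm[OF Cauchy_seqs_diff, of u v] lim_norm_eqI[of "\<lambda>n. u n - v n" 0]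
  by (auto simp: null_rel_def)

lemma equiv_null_rel: "equiv (Cauchy_seqs p) (null_rel p)"
proof (rule equivI)
  show "null_rel p \<subseteq> Cauchy_seqs p \<times> Cauchy_seqs p" by (auto simp: null_rel_iff)
  show "refl_on (Cauchy_seqs p) (null_rel p)" by (auto simp: refl_on_def null_rel_iff)
  show "sym (null_rel p)"
  proof (rule symI)
    fix u v assume "(u, v) \<in> null_rel p"
    then show "(v, u) \<in> null_rel p"
      using lim_norm_diff_commute[of u v] by (simp add: null_rel_iff)
  qed
  show "trans (null_rel p)"
  proof (rule transI)
    fix u v w assume "(u, v) \<in> null_rel p" "(v, w) \<in> null_rel p"
    then have *: "u \<in> Cauchy_seqs p" "v \<in> Cauchy_seqs p" "w \<in> Cauchy_seqs p"
        "lim_norm (\<lambda>n. u n - v n) = 0" "lim_norm (\<lambda>n. v n - w n) = 0"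
      by (simp_all add: null_rel_iff)
    have "lim_norm (\<lambda>n. u n - w n) \<le> 0"
      using lim_norm_diff_triangle[of u v w] * by simp
    moreover have "0 \<le> lim_norm (\<lambda>n. u n - w n)"
      using * by (intro lim_norm_nonneg Cauchy_seqs_diff)
    ultimately show "(u, w) \<in> null_rel p"
      using * by (simp add: null_rel_iff)
  qed
qed

definition cls :: "(nat \<Rightarrow> 'v) \<Rightarrow> (nat \<Rightarrow> 'v) set" where
  "cls u = null_rel p `` {u}"

lemma cls_eq_iff:
  assumes "u \<in> Cauchy_seqs p" "v \<in> Cauchy_seqs p"
  shows "cls u = cls v \<longleftrightarrow> lim_norm (\<lambda>n. u n - v n) = 0"
  unfolding cls_def eq_equiv_class_iff[OF equiv_null_rel assms] null_rel_iff using assms by blast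

lemma cls_eqI: "(u, v) \<in> null_rel p \<Longrightarrow> cls u = cls v"
  unfolding cls_def by (rule equiv_class_eq[OF equiv_null_rel])

lemma carrier_completion: "ns_carrier (ns_completion p) = cls ` Cauchy_seqs p"
  unfolding ns_completion_def nspace.simps quotient_def cls_def by blast

text \<open>Maps on the completion are written as unions over all representatives of a class. When
  equivalent sequences give the same set, all members of the union coincide, so any one
  representative computes it.\<close>

lemma UN_cls:
  assumes "u \<in> Cauchy_seqs p" "\<And>v w. (v, w) \<in> null_rel p \<Longrightarrow> f v = f w"
  shows "(\<Union>v\<in>cls u. f v) = f u"
  unfolding cls_def
proof (rule UN_equiv_class[OF equiv_null_rel _ assms(1)])
  show "f respects null_rel p" unfolding congruent_def using assms(2) by blast
qed

lemma add_completion: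
  assumes "u \<in> Cauchy_seqs p" "v \<in> Cauchy_seqs p"
  shows "ns_add (ns_completion p) (cls u) (cls v) = cls (\<lambda>n. u n + v n)"
proof -
  have "cls (\<lambda>n. u n + v n) = cls (\<lambda>n. u' n + v' n)"
    if "(u, u') \<in> null_rel p" "(v, v') \<in> null_rel p" for u u' v v'
  proof (rule cls_eqI)
    have *: "u \<in> Cauchy_seqs p" "u' \<in> Cauchy_seqs p" "v \<in> Cauchy_seqs p" "v' \<in> Cauchy_seqs p"
      using that by (auto simp: null_rel_iff)
    have "lim_norm (\<lambda>n. (u n - u' n) + (v n - v' n)) \<le> 0"
      using that lim_norm_add[OF Cauchy_seqs_diff Cauchy_seqs_diff, of u u' v v']
      by (auto simp: null_rel_iff)
    moreover have "lim_norm (\<lambda>n. (u n - u' n) + (v n - v' n)) \<ge> 0"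
      using * by (intro lim_norm_nonneg Cauchy_seqs_add Cauchy_seqs_diff)
    ultimately show "(\<lambda>n. u n + v n, \<lambda>n. u' n + v' n) \<in> null_rel p"
      using * by (simp add: null_rel_iff Cauchy_seqs_add algebra_simps)
  qed
  then have "(\<Union>u\<in>cls u. \<Union>v\<in>cls v. cls (\<lambda>n. u n + v n)) = cls (\<lambda>n. u n + v n)"
    unfolding cls_def
    by (intro UN_equiv_class2[OF equiv_null_rel equiv_null_rel] congruent2I' assms)
  then show ?thesis by (simp add: ns_completion_def cls_def)
qed

lemma scale_completion:
  assumes "u \<in> Cauchy_seqs p"
  shows "ns_scale (ns_completion p) c (cls u) = cls (\<lambda>n. c *\<^sub>R u n)"
proof -
  have "cls (\<lambda>n. c *\<^sub>R v n) = cls (\<lambda>n. c *\<^sub>R w n)" if "(v, w) \<in> null_rel p" for v w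
    using that lim_norm_scale[OF Cauchy_seqs_diff, of v w c]
    by (auto simp: null_rel_iff Cauchy_seqs_scale scaleR_diff_right intro!: cls_eqI)
  then have "(\<Union>v\<in>cls u. cls (\<lambda>n. c *\<^sub>R v n)) = cls (\<lambda>n. c *\<^sub>R u n)"
    by (rule UN_cls[OF assms])
  then show ?thesis by (simp add: ns_completion_def cls_def)
qed

text \<open>\<open>ns_norm\<close> applies \<open>the_elem\<close>, so the values of
  \<open>lim_norm\<close> on a class must form a singleton. The triangle inequality, used in both
  directions, shows that equivalent sequences have the same value.\<close>

lemma norm_completion:
  assumes "u \<in> Cauchy_seqs p"
  shows "ns_norm (ns_completion p) (cls u) = lim_norm u"
proof -
  have "lim_norm v = lim_norm u" if "(u, v) \<in> null_rel p" for v
  proof -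
    have v: "v \<in> Cauchy_seqs p" "lim_norm (\<lambda>n. u n - v n) = 0"
      using that by (auto simp: null_rel_iff)
    then show ?thesis
      using assms lim_norm_add[OF Cauchy_seqs_diff, of u v v] lim_norm_add[OF Cauchy_seqs_diff, of v u u]
      by (simp add: lim_norm_diff_commute[of v u])
  qed
  moreover have "u \<in> cls u" using assms by (simp add: cls_def null_rel_iff)
  ultimately have "lim_norm ` cls u = {lim_norm u}" unfolding cls_def by blast
  then show ?thesis by (simp add: ns_completion_def lim_norm_def[abs_def])
qed

lemma comb_completion:
  assumes "u \<in> Cauchy_seqs p" "v \<in> Cauchy_seqs p"
  shows "ns_comb (ns_completion p) t (cls u) (cls v) = cls (\<lambda>n. (1 - t) *\<^sub>R u n + t *\<^sub>R v n)"
  using assms by (simp add: ns_comb_def scale_completion add_completion Cauchy_seqs_scale)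

lemma dist_completion:
  assumes "u \<in> Cauchy_seqs p" "v \<in> Cauchy_seqs p"
  shows "ns_dist (ns_completion p) (cls u) (cls v) = lim_norm (\<lambda>n. u n - v n)"
  using assms Cauchy_seqs_diff[OF assms] Cauchy_seqs_scale[OF assms(2), of "-1"]
  by (simp add: ns_dist_def carrier_completion scale_completion add_completion norm_completion)

lemma Metric_space_completion:
  "Metric_space (ns_carrier (ns_completion p)) (ns_dist (ns_completion p))"
proof
  fix U V :: "(nat \<Rightarrow> 'v) set"
  let ?Z = "ns_completion p"
  show "0 \<le> ns_dist ?Z U V"
  proof (cases "U \<in> ns_carrier ?Z \<and> V \<in> ns_carrier ?Z")
    case True
    then show ?thesis
      by (auto simp: carrier_completion dist_completion Cauchy_seqs_diff lim_norm_nonneg)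
  qed (auto simp: ns_dist_def)
  show "ns_dist ?Z U V = ns_dist ?Z V U"
  proof (cases "U \<in> ns_carrier ?Z \<and> V \<in> ns_carrier ?Z")
    case True
    then obtain u v where "u \<in> Cauchy_seqs p" "U = cls u" "v \<in> Cauchy_seqs p" "V = cls v"
      by (auto simp: carrier_completion)
    then show ?thesis
      using lim_norm_diff_commute[of u v] by (simp add: dist_completion)
  qed (auto simp: ns_dist_def)
next
  fix U V W :: "(nat \<Rightarrow> 'v) set"
  let ?Z = "ns_completion p"
  assume U: "U \<in> ns_carrier ?Z" and V: "V \<in> ns_carrier ?Z"
  then obtain u v where "u \<in> Cauchy_seqs p" "U = cls u" "v \<in> Cauchy_seqs p" "V = cls v"
    by (auto simp: carrier_completion)
  then show "ns_dist ?Z U V = 0 \<longleftrightarrow> U = V"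
    by (simp add: dist_completion cls_eq_iff)
  assume W: "W \<in> ns_carrier ?Z"
  show "ns_dist ?Z U W \<le> ns_dist ?Z U V + ns_dist ?Z V W"
    using U V W by (auto simp: carrier_completion dist_completion lim_norm_diff_triangle)
qed

text \<open>The isometry extends to the closure of \<open>C\<close> in the completion. If \<open>c\<close> is close to a fixed point
  of the extension, then so are all its iterates.\<close>

lemma almost_fixed_point:
  assumes fpp: "fpp_affine_isometries (ns_completion p)"
    and S: "linear S" and iso: "\<And>v. p (S v) = p v"
    and C: "convex C" "C \<noteq> {}" "S ` C \<subseteq> C" and bdd: "\<And>c. c \<in> C \<Longrightarrow> p c \<le> B"
    and e: "e > 0"
  obtains c where "c \<in> C" "\<And>M. p (c - (S ^^ M) c) < e"
proof -
  let ?Z = "ns_completion p"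
  interpret Metric_space "ns_carrier ?Z" "ns_dist ?Z" by (rule Metric_space_completion)
  interpret S: linear S by (rule S)
  \<comment> \<open>Constant sequences represent the vectors themselves. The closure is closed by
    construction; convexity, boundedness and invariance are obtained by approximating with elements
    of \<open>C\<close>.\<close>
  define D where "D = mtopology closure_of ((\<lambda>c. cls (\<lambda>n. c)) ` C)"
  \<comment> \<open>No representative is chosen: since \<open>S\<close> preserves \<open>p\<close>
    on differences, equivalent sequences have equivalent images.\<close>
  define T where "T = (\<lambda>U. \<Union>u\<in>U. cls (\<lambda>n. S (u n)))"
  have SC: "(\<lambda>n. S (u n)) \<in> Cauchy_seqs p" if "u \<in> Cauchy_seqs p" for u
    using Cauchy_seqs_image[OF that, of S] by (simp add: iso flip: S.diff)
  have Slim: "lim_norm (\<lambda>n. S (u n) - S (v n)) = lim_norm (\<lambda>n. u n - v n)" for u v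
    by (simp add: lim_norm_def iso flip: S.diff)
  have T: "T (cls u) = cls (\<lambda>n. S (u n))" if "u \<in> Cauchy_seqs p" for u
    unfolding T_def
    by (rule UN_cls[OF that]) (auto simp: null_rel_iff SC Slim cls_eqI)
  have D_sub: "D \<subseteq> ns_carrier ?Z" by (auto simp: D_def metric_closure_of)
  have D_iff: "cls u \<in> D \<longleftrightarrow> (\<forall>r>0. \<exists>c\<in>C. lim_norm (\<lambda>n. u n - c) < r)"
    if "u \<in> Cauchy_seqs p" for u
  proof -
    have "cls u \<in> ns_carrier ?Z" "cls (\<lambda>n. c) \<in> ns_carrier ?Z" for c
      using that by (auto simp: carrier_completion)
    then show ?thesis
      using that by (simp add: D_def metric_closure_of dist_completion)
  qed
  have DE: "\<exists>u\<in>Cauchy_seqs p. U = cls u \<and> (\<forall>r>0. \<exists>c\<in>C. lim_norm (\<lambda>n. u n - c) < r)" if U: "U \<in> D" for U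
  proof -
    obtain u where "u \<in> Cauchy_seqs p" "U = cls u"
      using U D_sub unfolding carrier_completion by blast
    with U D_iff show ?thesis by blast
  qed
  have "D \<noteq> {}"
  proof -
    obtain c where "c \<in> C" using C by blast
    then have "cls (\<lambda>n. c) \<in> D" by (subst D_iff) (auto intro!: bexI[of _ c])
    then show ?thesis by blast
  qed
  moreover have "ns_closed ?Z D" by (simp add: ns_closed_def D_def)
  moreover have "ns_convex ?Z D"
    unfolding ns_convex_def
  proof (intro ballI)
    fix U V and t :: real assume UV: "U \<in> D" "V \<in> D" and t: "t \<in> {0..1}"
    obtain u where u: "u \<in> Cauchy_seqs p" "U = cls u" "\<And>r. r > 0 \<Longrightarrow> \<exists>c\<in>C. lim_norm (\<lambda>n. u n - c) < r"
      using DE[OF UV(1)] by blast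
    obtain v where v: "v \<in> Cauchy_seqs p" "V = cls v" "\<And>r. r > 0 \<Longrightarrow> \<exists>c\<in>C. lim_norm (\<lambda>n. v n - c) < r"
      using DE[OF UV(2)] by blast
    have "\<exists>c\<in>C. lim_norm (\<lambda>n. ((1 - t) *\<^sub>R u n + t *\<^sub>R v n) - c) < r" if r: "r > 0" for r
    proof -
      obtain c d where c: "c \<in> C" "lim_norm (\<lambda>n. u n - c) < r" and d: "d \<in> C" "lim_norm (\<lambda>n. v n - d) < r"
        using u(3)[OF r] v(3)[OF r] by blast
      have "lim_norm (\<lambda>n. ((1 - t) *\<^sub>R u n + t *\<^sub>R v n) - ((1 - t) *\<^sub>R c + t *\<^sub>R d))
          = lim_norm (\<lambda>n. (1 - t) *\<^sub>R (u n - c) + t *\<^sub>R (v n - d))"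
        by (simp add: algebra_simps)
      also have "\<dots> \<le> lim_norm (\<lambda>n. (1 - t) *\<^sub>R (u n - c)) + lim_norm (\<lambda>n. t *\<^sub>R (v n - d))"
        by (intro lim_norm_add Cauchy_seqs_scale Cauchy_seqs_diff u v Cauchy_seqs_const)
      also have "\<dots> = (1 - t) * lim_norm (\<lambda>n. u n - c) + t * lim_norm (\<lambda>n. v n - d)"
        using t by (simp add: lim_norm_scale Cauchy_seqs_diff u v)
      also have "\<dots> < r"
        using t c d by (intro convex_bound_lt) auto
      finally show ?thesis
        using t c d C(1) by (intro bexI[of _ "(1 - t) *\<^sub>R c + t *\<^sub>R d"]) (auto simp: convex_alt)
    qed
    then show "ns_comb ?Z t U V \<in> D"
      by (simp add: u v comb_completion D_iff Cauchy_seqs_add Cauchy_seqs_scale)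
  qed
  moreover have "ns_bounded ?Z D"
    unfolding ns_bounded_def
  proof (intro exI ballI)
    fix U assume "U \<in> D"
    then obtain u c where u: "u \<in> Cauchy_seqs p" "U = cls u" and c: "c \<in> C" "lim_norm (\<lambda>n. u n - c) < 1"
      using DE[of U] zero_less_one by blast
    have "lim_norm u \<le> lim_norm (\<lambda>n. u n - c) + lim_norm (\<lambda>n. c)"
      using lim_norm_add[OF Cauchy_seqs_diff, of u "\<lambda>n. c" "\<lambda>n. c"] u by simp
    then show "ns_norm ?Z U \<le> 1 + B"
      using c bdd[OF c(1)] by (simp add: u norm_completion)
  qed
  moreover have "affine_isometry_on ?Z D T"
    unfolding affine_isometry_on_def
  proof (intro conjI ballI funcsetI)
    fix U assume "U \<in> D"
    then obtain u where u: "u \<in> Cauchy_seqs p" "U = cls u" "\<And>r. r > 0 \<Longrightarrow> \<exists>c\<in>C. lim_norm (\<lambda>n. u n - c) < r"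
      using DE by blast
    have "\<exists>c\<in>C. lim_norm (\<lambda>n. S (u n) - c) < r" if r: "r > 0" for r
    proof -
      obtain c where "c \<in> C" "lim_norm (\<lambda>n. u n - c) < r" using u(3)[OF r] by blast
      then show ?thesis
        using C(3) Slim[of u "\<lambda>n. c"] by (intro bexI[of _ "S c"]) auto
    qed
    then show "T U \<in> D" by (simp add: u T D_iff SC)
  next
    fix U V assume "U \<in> D" "V \<in> D"
    then obtain u v where uv: "u \<in> Cauchy_seqs p" "U = cls u" "v \<in> Cauchy_seqs p" "V = cls v"
      using DE by metis
    then show "ns_dist ?Z (T U) (T V) = ns_dist ?Z U V"
      by (simp add: T dist_completion SC Slim)
    show "T (ns_comb ?Z t U V) = ns_comb ?Z t (T U) (T V)" for t
      using uv by (simp add: T comb_completion SC S.add S.scale Cauchy_seqs_add Cauchy_seqs_scale)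
  qed
  ultimately obtain z where z: "z \<in> D" "T z = z"
    using fpp D_sub unfolding fpp_affine_isometries_def by meson
  have "e / 2 > 0" using e by simp
  with DE[OF z(1)] obtain u c where u: "u \<in> Cauchy_seqs p" "z = cls u"
    and c: "c \<in> C" "lim_norm (\<lambda>n. u n - c) < e / 2" by blast
  have fix_u: "lim_norm (\<lambda>n. S (u n) - u n) = 0"
    using z(2) u T SC by (simp add: cls_eq_iff)
  \<comment> \<open>In the induction step the route through \<open>S (u n)\<close> costs nothing, as
    \<open>u\<close> and its image are at distance 0, and \<open>S\<close> keeps the remaining
    distance. So the strict bound does not grow with \<open>M\<close>.\<close>
  have near: "lim_norm (\<lambda>n. u n - (S ^^ M) c) < e / 2" for M
  proof (induction M)
    case (Suc M)
    have "lim_norm (\<lambda>n. u n - S ((S ^^ M) c)) \<le>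
        lim_norm (\<lambda>n. u n - S (u n)) + lim_norm (\<lambda>n. S (u n) - S ((S ^^ M) c))"
      by (intro lim_norm_diff_triangle u SC Cauchy_seqs_const)
    then show ?case
      using Suc fix_u Slim[of u "\<lambda>n. (S ^^ M) c"] lim_norm_diff_commute[of u "\<lambda>n. S (u n)"] by simp
  qed (use c in simp)
  have "p (c - (S ^^ M) c) < e" for M
    using lim_norm_diff_triangle[of "\<lambda>n. c" u "\<lambda>n. (S ^^ M) c"] u c near[of M]
    by (simp add: lim_norm_diff_commute[of "\<lambda>n. c" u])
  then show thesis using c(1) that by blast
qed

end

section \<open>The spreading norm\<close>

text \<open>The linear map on c_00 that takes the unit vectors to the terms of \<open>y\<close>. For
  \<open>y i = x (n i)\<close> it is the sum inside the limit of
  \<open>spreading_norm\<close>.\<close>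

definition lin :: "(nat \<Rightarrow> 'v::real_vector) \<Rightarrow> (nat \<Rightarrow>\<^sub>0 real) \<Rightarrow> 'v" where
  "lin y a = (\<Sum>i\<in>Poly_Mapping.keys a. Poly_Mapping.lookup a i *\<^sub>R y i)"

abbreviation unit_vec :: "nat \<Rightarrow> nat \<Rightarrow>\<^sub>0 real" where
  "unit_vec i \<equiv> Poly_Mapping.single i 1"

lemma lookup_scaleR: "Poly_Mapping.lookup (c *\<^sub>R a) i = c *\<^sub>R Poly_Mapping.lookup a i"
  for a :: "'k \<Rightarrow>\<^sub>0 'b::real_vector"
proof -
  have "finite {i. c *\<^sub>R Poly_Mapping.lookup a i \<noteq> 0}"
    by (rule finite_subset[OF _ finite_keys[of a]]) (auto simp: in_keys_iff)
  then show ?thesis by (simp add: scaleR_poly_mapping_def Abs_poly_mapping_inverse)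
qed

text \<open>Coefficients off the support vanish, so combinations with different supports can be
  compared over one index set.\<close>

lemma lin_eq:
  assumes "finite A" "Poly_Mapping.keys a \<subseteq> A"
  shows "lin y a = (\<Sum>i\<in>A. Poly_Mapping.lookup a i *\<^sub>R y i)"
  unfolding lin_def using assms by (intro sum.mono_neutral_left) (auto simp: in_keys_iff)

lemma linear_lin: "linear (lin y)"
proof
  fix a b :: "nat \<Rightarrow>\<^sub>0 real" and c :: real
  let ?A = "Poly_Mapping.keys a \<union> Poly_Mapping.keys b"
  have "lin y (a + b) = (\<Sum>i\<in>?A. Poly_Mapping.lookup (a + b) i *\<^sub>R y i)"
    using keys_add[of a b] by (intro lin_eq) auto
  also have "\<dots> = (\<Sum>i\<in>?A. Poly_Mapping.lookup a i *\<^sub>R y i) + (\<Sum>i\<in>?A. Poly_Mapping.lookup b i *\<^sub>R y i)"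
    by (simp add: lookup_add scaleR_add_left sum.distrib)
  also have "\<dots> = lin y a + lin y b"
    by (intro arg_cong2[of _ _ _ _ "(+)"] lin_eq[symmetric]) auto
  finally show "lin y (a + b) = lin y a + lin y b" .
  have "lin y (c *\<^sub>R a) = (\<Sum>i\<in>Poly_Mapping.keys a. Poly_Mapping.lookup (c *\<^sub>R a) i *\<^sub>R y i)"
    by (intro lin_eq) (auto simp: lookup_scaleR in_keys_iff)
  then show "lin y (c *\<^sub>R a) = c *\<^sub>R lin y a"
    by (simp add: lin_def lookup_scaleR scaleR_sum_right)
qed

lemma lin_unit_vec [simp]: "lin y (unit_vec i) = y i"
  by (simp add: lin_def)

lemma lin_lin: "linear f \<Longrightarrow> f (lin y a) = lin (\<lambda>i. f (y i)) a"
  by (simp add: lin_def linear_sum linear_scale)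

text \<open>Prescribed on the unit vectors, so that linearity is inherited from
  \<open>lin\<close>.\<close>

definition shift :: "(nat \<Rightarrow>\<^sub>0 real) \<Rightarrow> (nat \<Rightarrow>\<^sub>0 real)" where
  "shift = lin (\<lambda>i. unit_vec (Suc i))"

lemma linear_shift: "linear shift"
  by (simp add: shift_def linear_lin)

text \<open>Moving the coefficients to the right has the same effect as dropping the first term of
  the sequence. This turns iterates of \<open>shift\<close> into combinations of later
  terms.\<close>

lemma lin_shift: "lin y (shift a) = lin (\<lambda>i. y (Suc i)) a"
  by (simp add: shift_def lin_lin[OF linear_lin])

lemma lin_shift_funpow: "lin y ((shift ^^ M) a) = lin (\<lambda>i. y (M + i)) a"
  by (induction M arbitrary: y) (simp_all add: lin_shift)

section \<open>Limits over increasing index sequences\<close>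

lemma eventually_spread_filter:
  "eventually P spread_filter \<longleftrightarrow> (\<exists>N. \<forall>n. strict_mono n \<and> N \<le> n 0 \<longrightarrow> P n)"
  unfolding spread_filter_def eventually_inf_principal eventually_filtercomap_at_top_linorder mem_Collect_eq
  by (intro arg_cong[of _ _ Ex] ext) blast

text \<open>Makes limits along the filter unique. Beyond each threshold \<open>N\<close> there is
  the sequence of consecutive indices starting at \<open>N\<close>.\<close>

lemma spread_filter_neq_bot [simp]: "spread_filter \<noteq> bot"
proof -
  have "strict_mono (\<lambda>i::nat. N + i)" for N
    by (simp add: strict_mono_def)
  then have "\<not> eventually (\<lambda>_. False) spread_filter"
    unfolding eventually_spread_filter by (metis add.right_neutral order_refl)
  then show ?thesis by (metis eventually_bot)
qed

text \<open>Removing the first entry of an increasing sequence leaves an increasing sequence that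
  starts later. This is the source of the shift invariance of spreading norms.\<close>

lemma filterlim_Suc_spread_filter: "filterlim (\<lambda>n i. n (Suc i)) spread_filter spread_filter"
  unfolding filterlim_iff eventually_spread_filter
proof (intro allI impI)
  fix P :: "(nat \<Rightarrow> nat) \<Rightarrow> bool"
  assume "\<exists>N. \<forall>n. strict_mono n \<and> N \<le> n 0 \<longrightarrow> P n"
  then obtain N where N: "\<And>n. strict_mono n \<Longrightarrow> N \<le> n 0 \<Longrightarrow> P n" by blast
  have "P (\<lambda>i. n (Suc i))" if "strict_mono n" "N \<le> n 0" for n
    using that strict_mono_less[OF that(1), of 0 1]
    by (intro N) (auto intro: strict_monoI dest: strict_monoD)
  then show "\<exists>N. \<forall>n. strict_mono n \<and> N \<le> n 0 \<longrightarrow> P (\<lambda>i. n (Suc i))" by blast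
qed

text \<open>\<open>good_seq\<close> speaks of sums over \<open>i < k\<close>,
  \<open>spreading_norm\<close> of sums over the support. They agree as soon as \<open>k\<close>
  bounds the support.\<close>

lemma tendsto_spreading_norm:
  assumes "good_seq x"
  shows "((\<lambda>n. norm (lin (\<lambda>i. x (n i)) a)) \<longlongrightarrow> spreading_norm x a) spread_filter"
proof -
  obtain k where "Poly_Mapping.keys a \<subseteq> {..<k}"
    using finite_nat_iff_bounded[of "Poly_Mapping.keys a"] by auto
  then have lin: "lin (\<lambda>i. x (n i)) a = (\<Sum>i<k. Poly_Mapping.lookup a i *\<^sub>R x (n i))" for n
    by (simp add: lin_eq)
  obtain l where l: "((\<lambda>n. norm (lin (\<lambda>i. x (n i)) a)) \<longlongrightarrow> l) spread_filter"
    unfolding lin using assms[unfolded good_seq_def, rule_format, of "Poly_Mapping.lookup a" k] by (elim exE)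
  then have "spreading_norm x a = l"
    unfolding spreading_norm_def by (intro tendsto_Lim) (simp_all add: lin_def)
  with l show ?thesis by simp
qed

lemma real_seminorm_spreading_norm:
  assumes "good_seq x"
  shows "real_seminorm (spreading_norm x)"
proof
  fix a b :: "nat \<Rightarrow>\<^sub>0 real" and c :: real
  note lim = tendsto_spreading_norm[OF assms]
  show "spreading_norm x (a + b) \<le> spreading_norm x a + spreading_norm x b"
    by (rule tendsto_le[OF spread_filter_neq_bot tendsto_add[OF lim lim] lim])
       (simp add: linear_add[OF linear_lin] norm_triangle_ineq)
  have "((\<lambda>n. norm (lin (\<lambda>i. x (n i)) (c *\<^sub>R a))) \<longlongrightarrow> \<bar>c\<bar> * spreading_norm x a) spread_filter"
    by (simp add: linear_scale[OF linear_lin] tendsto_mult_left lim)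
  then show "spreading_norm x (c *\<^sub>R a) = \<bar>c\<bar> * spreading_norm x a"
    by (rule tendsto_unique[OF spread_filter_neq_bot lim])
qed

lemma spreading_norm_shift:
  assumes "good_seq x"
  shows "spreading_norm x (shift a) = spreading_norm x a"
proof (rule tendsto_unique[OF spread_filter_neq_bot tendsto_spreading_norm[OF assms]])
  show "((\<lambda>n. norm (lin (\<lambda>i. x (n i)) (shift a))) \<longlongrightarrow> spreading_norm x a) spread_filter"
    unfolding lin_shift
    using filterlim_compose[OF tendsto_spreading_norm[OF assms] filterlim_Suc_spread_filter] .
qed

section \<open>Cesaro means\<close>

text \<open>The windows \<open>{i..<n + i}\<close> and \<open>{..<n}\<close> differ by at most
  \<open>i\<close> terms at either end, so the sum of the differences stays within
  \<open>2 * i * B\<close> while it is divided by \<open>n\<close>.\<close>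

lemma cesaro_shift_tendsto:
  fixes x :: "nat \<Rightarrow> 'a::real_normed_vector"
  assumes "bounded (range x)"
  shows "(\<lambda>n. (1 / real n) *\<^sub>R (\<Sum>k<n. x (k + i) - x k)) \<longlonglongrightarrow> 0"
proof -
  obtain B where B: "\<And>k. norm (x k) \<le> B"
    using assms by (auto simp: bounded_iff)
  have telescope: "(\<Sum>k<n. x (k + i) - x k) = (\<Sum>j<i. x (n + j) - x j)" for n
  proof (induction n)
    case (Suc n)
    have "(\<Sum>j<i. x (Suc n + j) - x (n + j)) = x (n + i) - x n"
      using sum_lessThan_telescope[of "\<lambda>j. x (n + j)" i] by simp
    then have "(\<Sum>j<i. x (Suc n + j)) = (\<Sum>j<i. x (n + j)) + x (n + i) - x n"
      by (simp add: sum_subtractf algebra_simps)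
    then show ?case using Suc by (simp add: sum_subtractf)
  qed simp
  have "norm ((1 / real n) *\<^sub>R (\<Sum>k<n. x (k + i) - x k)) \<le> (real i * (2 * B)) * (1 / real n)" for n
  proof -
    have "norm (\<Sum>j<i. x (n + j) - x j) \<le> (\<Sum>j<i. 2 * B)"
      using B norm_triangle_ineq4[of "x (n + j)" "x j" for j]
      by (intro sum_norm_le) (smt (verit))
    then show ?thesis by (simp add: telescope divide_right_mono)
  qed
  then have "eventually (\<lambda>n. norm ((1 / real n) *\<^sub>R (\<Sum>k<n. x (k + i) - x k))
      \<le> (real i * (2 * B)) * (1 / real n)) sequentially"
    by (intro always_eventually allI)
  then show ?thesis
    by (rule Lim_null_comparison[OF _ tendsto_mult_right_zero[OF lim_1_over_n]])
qed

text \<open>For a unit vector this is \<open>cesaro_shift_tendsto\<close>. The property survives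
  convex combinations because weights of sum 1 split the subtracted \<open>x k\<close> in the same
  proportion.\<close>

lemma cesaro_lin_tendsto:
  fixes x :: "nat \<Rightarrow> 'a::real_normed_vector"
  assumes bdd: "bounded (range x)" and c: "c \<in> convex hull (range unit_vec)"
  shows "(\<lambda>n. (1 / real n) *\<^sub>R (\<Sum>k<n. lin (\<lambda>i. x (k + i)) c - x k)) \<longlonglongrightarrow> 0"
proof (rule hull_induct[OF c])
  show "(\<lambda>n. (1 / real n) *\<^sub>R (\<Sum>k<n. lin (\<lambda>i. x (k + i)) a - x k)) \<longlonglongrightarrow> 0"
    if "a \<in> range unit_vec" for a
    using that cesaro_shift_tendsto[OF bdd] by force
next
  let ?f = "\<lambda>c n. (1 / real n) *\<^sub>R (\<Sum>k<n. lin (\<lambda>i. x (k + i)) c - x k)"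
  have "?f (u *\<^sub>R a + v *\<^sub>R b) \<longlonglongrightarrow> 0"
    if lim: "?f a \<longlonglongrightarrow> 0" "?f b \<longlonglongrightarrow> 0" and uv: "u + v = 1" for a b u v
  proof -
    have x: "x k = u *\<^sub>R x k + v *\<^sub>R x k" for k
      using uv by (simp flip: scaleR_add_left)
    have "lin (\<lambda>i. x (k + i)) (u *\<^sub>R a + v *\<^sub>R b) - x k =
        u *\<^sub>R (lin (\<lambda>i. x (k + i)) a - x k) + v *\<^sub>R (lin (\<lambda>i. x (k + i)) b - x k)" for k
      by (subst (2) x) (simp add: linear_add[OF linear_lin] linear_scale[OF linear_lin] algebra_simps)
    then have "?f (u *\<^sub>R a + v *\<^sub>R b) = (\<lambda>n. u *\<^sub>R ?f a n + v *\<^sub>R ?f b n)"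
      by (simp add: sum.distrib scaleR_add_right mult.commute flip: scaleR_sum_right)
    then show ?thesis
      using tendsto_add[OF tendsto_scaleR[OF tendsto_const lim(1)] tendsto_scaleR[OF tendsto_const lim(2)], of u v]
      by simp
  qed
  then show "convex {c. ?f c \<longlonglongrightarrow> 0}" by (auto intro!: convexI)
qed

text \<open>The first \<open>K\<close> terms contribute a constant divided by \<open>n\<close>,
  eventually below \<open>e\<close>; the later ones contribute at most \<open>e\<close> on average.
  Hence the factor 2.\<close>

lemma cesaro_eventually_near:
  fixes w :: "nat \<Rightarrow> 'a::real_normed_vector"
  assumes ev: "eventually (\<lambda>k. norm (w k - W) < e) sequentially" and e: "e > 0"
  shows "eventually (\<lambda>n. norm ((1 / real n) *\<^sub>R (\<Sum>k<n. w k) - W) < 2 * e) sequentially"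
proof -
  obtain K where K: "\<And>k. k \<ge> K \<Longrightarrow> norm (w k - W) < e"
    using ev by (auto simp: eventually_sequentially)
  define A where "A = (\<Sum>k<K. norm (w k - W))"
  have "(\<lambda>n. A * (1 / real n)) \<longlonglongrightarrow> 0"
    by (intro tendsto_mult_right_zero lim_1_over_n)
  then have "eventually (\<lambda>n. A * (1 / real n) < e) sequentially"
    using e by (rule order_tendstoD)
  \<comment> \<open>The case \<open>n = 0\<close> is excluded because \<open>1 / 0 = 0\<close> would
    make the mean of the constant \<open>W\<close> equal to 0.\<close>
  then show ?thesis
    using eventually_gt_at_top[of 0] eventually_ge_at_top[of K]
  proof eventually_elim
    case (elim n)
    have "norm ((1 / real n) *\<^sub>R (\<Sum>k<n. w k) - W) = norm ((1 / real n) *\<^sub>R (\<Sum>k<n. w k - W))"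
      using elim by (simp add: sum_subtractf scaleR_diff_right sum_constant_scaleR)
    also have "\<dots> \<le> (1 / real n) * (\<Sum>k<n. norm (w k - W))"
      by (simp add: divide_right_mono norm_sum)
    also have "(\<Sum>k<n. norm (w k - W)) = A + (\<Sum>k=K..<n. norm (w k - W))"
      using sum.atLeastLessThan_concat[of 0 K n "\<lambda>k. norm (w k - W)"] elim
      by (simp add: A_def atLeast0LessThan)
    also have "(\<Sum>k=K..<n. norm (w k - W)) \<le> (\<Sum>k=K..<n. e)"
      using K by (intro sum_mono less_imp_le) auto
    also have "\<dots> \<le> real n * e" using e by (simp add: mult_right_mono)
    also have "(1 / real n) * (A + real n * e) = A * (1 / real n) + e"
      using elim by (simp add: field_simps)
    also have "\<dots> < 2 * e" using elim by simp
    finally show ?case by (simp add: divide_right_mono)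
  qed
qed

text \<open>A criterion that serves both convergent sequences and those covered by the fixed point
  property. Both \<open>c\<close> and \<open>W\<close> may vary with \<open>e\<close>, which
  suffices for a Cauchy sequence.\<close>

lemma cesaro_convergent:
  fixes x :: "nat \<Rightarrow> 'a::banach"
  assumes bdd: "bounded (range x)"
    and near: "\<And>e. e > 0 \<Longrightarrow> \<exists>c \<in> convex hull (range unit_vec). \<exists>W.
      eventually (\<lambda>k. norm (lin (\<lambda>i. x (k + i)) c - W) < e) sequentially"
  shows "convergent (\<lambda>n. (1 / real n) *\<^sub>R (\<Sum>k<n. x k))"
proof -
  have "Cauchy (\<lambda>n. (1 / real n) *\<^sub>R (\<Sum>k<n. x k))" (is "Cauchy ?C")
  proof (rule metric_CauchyI)
    fix e :: real assume e: "e > 0"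
    \<comment> \<open>Averaging doubles \<open>e / 8\<close> to \<open>e / 4\<close>, and replacing
      \<open>x\<close> by its combinations costs another \<open>e / 4\<close>. Each mean is then
      within \<open>e / 2\<close> of \<open>W\<close>, and two means within \<open>e\<close> of each
      other.\<close>
    then obtain c W where c: "c \<in> convex hull (range unit_vec)"
      and ev: "eventually (\<lambda>k. norm (lin (\<lambda>i. x (k + i)) c - W) < e / 8) sequentially"
      using near[of "e / 8"] by auto
    have "eventually (\<lambda>n. norm ((1 / real n) *\<^sub>R (\<Sum>k<n. lin (\<lambda>i. x (k + i)) c - x k)) < e / 4) sequentially"
      using order_tendstoD(2)[OF tendsto_norm_zero[OF cesaro_lin_tendsto[OF bdd c]], of "e / 4"] e by simp
    moreover have "eventually (\<lambda>n. norm ((1 / real n) *\<^sub>R (\<Sum>k<n. lin (\<lambda>i. x (k + i)) c) - W) < 2 * (e / 8)) sequentially"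
      using e by (intro cesaro_eventually_near[OF ev]) simp
    ultimately have "eventually (\<lambda>n. norm (?C n - W) < e / 2) sequentially"
    proof eventually_elim
      case (elim n)
      let ?v = "(1 / real n) *\<^sub>R (\<Sum>k<n. lin (\<lambda>i. x (k + i)) c)"
      have "norm (?C n - W) \<le> norm (?C n - ?v) + norm (?v - W)"
        using norm_triangle_ineq[of "?C n - ?v" "?v - W"] by simp
      moreover have "norm (?C n - ?v) = norm ((1 / real n) *\<^sub>R (\<Sum>k<n. lin (\<lambda>i. x (k + i)) c - x k))"
        by (subst norm_minus_commute) (simp add: sum_subtractf scaleR_diff_right)
      ultimately show ?case using elim by linarith
    qed
    then obtain N where N: "\<And>n. n \<ge> N \<Longrightarrow> norm (?C n - W) < e / 2"
      by (auto simp: eventually_sequentially)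
    have "dist (?C m) (?C n) < e" if "m \<ge> N" "n \<ge> N" for m n
      using dist_triangle_half_l[of "?C m" W e "?C n"] N[OF that(1)] N[OF that(2)] by (simp add: dist_norm)
    then show "\<exists>M. \<forall>m\<ge>M. \<forall>n\<ge>M. dist (?C m) (?C n) < e" by blast
  qed
  then show ?thesis by (simp add: Cauchy_convergent_iff)
qed

text \<open>The criterion holds with \<open>unit_vec 0\<close> as the combination and the limit of
  \<open>x\<close> as \<open>W\<close>, whatever the precision.\<close>

lemma cesaro_convergent_of_convergent:
  fixes x :: "nat \<Rightarrow> 'a::banach"
  assumes "convergent x"
  shows "convergent (\<lambda>n. (1 / real n) *\<^sub>R (\<Sum>k<n. x k))"
proof (rule cesaro_convergent)
  show "bounded (range x)" using assms by (intro Bseq_eq_bounded[THEN iffD1] convergent_imp_Bseq)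
  fix e :: real assume "e > 0"
  moreover obtain W where "x \<longlonglongrightarrow> W" using assms by (auto simp: convergent_def)
  ultimately have "eventually (\<lambda>k. norm (x k - W) < e) sequentially"
    by (simp add: tendsto_iff dist_norm)
  then show "\<exists>c \<in> convex hull (range unit_vec). \<exists>W.
      eventually (\<lambda>k. norm (lin (\<lambda>i. x (k + i)) c - W) < e) sequentially"
    by (intro bexI[of _ "unit_vec 0"] exI[of _ W] hull_inc rangeI) (simp only: lin_unit_vec add_0_right)
qed

text \<open>Evaluating \<open>c - (shift ^^ M) c\<close> on the indices \<open>K, \<dots>, K + M - 1, k, k + 1, \<dots>\<close>, where \<open>M\<close>
  exceeds the support of \<open>c\<close>, compares the combinations of \<open>x\<close> starting at \<open>K\<close> and at \<open>k\<close>.\<close>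

lemma cesaro_convergent_of_fpp:
  fixes x :: "nat \<Rightarrow> 'a::banach"
  assumes bdd: "bounded (range x)" and good: "good_seq x"
    and fpp: "fpp_affine_isometries (ns_completion (spreading_norm x))"
  shows "convergent (\<lambda>n. (1 / real n) *\<^sub>R (\<Sum>k<n. x k))"
proof (rule cesaro_convergent[OF bdd])
  fix e :: real assume e: "e > 0"
  interpret real_seminorm "spreading_norm x" by (rule real_seminorm_spreading_norm[OF good])
  define C where "C = convex hull (range unit_vec)"
  have shift_C: "shift ` C \<subseteq> C"
    unfolding C_def convex_hull_linear_image[OF linear_shift]
    by (rule hull_mono) (auto simp: shift_def)
  obtain B where B: "\<And>k. norm (x k) \<le> B"
    using bdd by (auto simp: bounded_iff)
  have "C \<subseteq> {c. spreading_norm x c \<le> B}"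
    unfolding C_def
  proof (rule hull_minimal)
    have "spreading_norm x (unit_vec i) \<le> B" for i
      by (rule tendsto_upperbound[OF tendsto_spreading_norm[OF good]]) (simp_all add: B)
    then show "range unit_vec \<subseteq> {c. spreading_norm x c \<le> B}" by blast
    show "convex {c. spreading_norm x c \<le> B}"
    proof (rule convexI)
      fix a b and u v :: real
      assume ab: "a \<in> {c. spreading_norm x c \<le> B}" "b \<in> {c. spreading_norm x c \<le> B}"
        and uv: "0 \<le> u" "0 \<le> v" "u + v = 1"
      have "spreading_norm x (u *\<^sub>R a + v *\<^sub>R b) \<le> u * spreading_norm x a + v * spreading_norm x b"
        using p_add[of "u *\<^sub>R a" "v *\<^sub>R b"] uv by (simp add: p_scale)
      also have "\<dots> \<le> B" using ab uv by (intro convex_bound_le) auto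
      finally show "u *\<^sub>R a + v *\<^sub>R b \<in> {c. spreading_norm x c \<le> B}" by simp
    qed
  qed
  then have bdd_C: "spreading_norm x c \<le> B" if "c \<in> C" for c using that by blast
  have "convex C" "C \<noteq> {}" by (auto simp: C_def)
  then obtain c where c: "c \<in> C" and small: "\<And>M. spreading_norm x (c - (shift ^^ M) c) < e"
    using almost_fixed_point[OF fpp linear_shift spreading_norm_shift[OF good] _ _ shift_C bdd_C e]
    by metis
  obtain M where M: "Poly_Mapping.keys c \<subseteq> {..<M}"
    using finite_nat_iff_bounded[of "Poly_Mapping.keys c"] by auto
  have "eventually (\<lambda>n. norm (lin (\<lambda>i. x (n i)) (c - (shift ^^ M) c)) < e) spread_filter"
    by (rule order_tendstoD(2)[OF tendsto_spreading_norm[OF good] small])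
  then obtain K where K: "\<And>n. strict_mono n \<Longrightarrow> K \<le> n 0 \<Longrightarrow>
      norm (lin (\<lambda>i. x (n i)) c - lin (\<lambda>i. x (n (M + i))) c) < e"
    unfolding eventually_spread_filter by (auto simp: linear_diff[OF linear_lin] lin_shift_funpow)
  have "norm (lin (\<lambda>i. x (k + i)) c - lin (\<lambda>i. x (K + i)) c) < e" if k: "k \<ge> K + M" for k
  proof -
    \<comment> \<open>The junction from \<open>K + M - 1\<close> to \<open>k\<close> increases
      because \<open>k \<ge> K + M\<close>. The definition also covers \<open>M = 0\<close>, where
      the sequence starts at \<open>k\<close>.\<close>
    define n where "n = (\<lambda>i. if i < M then K + i else k + (i - M))"
    have "strict_mono n"
      using k by (auto simp: strict_mono_def n_def)
    moreover have "K \<le> n 0" using k by (simp add: n_def)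
    moreover have "lin (\<lambda>i. x (n i)) c = lin (\<lambda>i. x (K + i)) c"
      using M by (auto simp: lin_def n_def intro!: sum.cong)
    moreover have "(\<lambda>i. x (n (M + i))) = (\<lambda>i. x (k + i))" by (simp add: n_def)
    ultimately show ?thesis using K[of n] by (simp add: norm_minus_commute)
  qed
  \<comment> \<open>The combination starting at the fixed index \<open>K\<close> plays the role of
    \<open>W\<close>.\<close>
  then have "eventually (\<lambda>k. norm (lin (\<lambda>i. x (k + i)) c - lin (\<lambda>i. x (K + i)) c) < e) sequentially"
    unfolding eventually_sequentially by blast
  then show "\<exists>c \<in> convex hull (range unit_vec). \<exists>W.
      eventually (\<lambda>k. norm (lin (\<lambda>i. x (k + i)) c - W) < e) sequentially"
    using c unfolding C_def by blast
qed

section \<open>Good subsequences\<close>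

text \<open>By \<open>dep\<close>, \<open>f\<close> is a colouring of increasing
  \<open>k\<close>-tuples, and a \<open>k\<close>-set is coloured through its sorted list, padded by
  0. If \<open>r\<close> enumerates a homogeneous set, the first \<open>k\<close> values of
  \<open>r \<circ> n\<close> are already sorted, so the colour of their set is
  \<open>f (r \<circ> n)\<close>.\<close>

lemma ramsey_strict_mono:
  fixes f :: "(nat \<Rightarrow> nat) \<Rightarrow> nat"
  assumes bdd: "\<And>n. f n < s"
    and dep: "\<And>n n'. (\<And>i. i < k \<Longrightarrow> n i = n' i) \<Longrightarrow> f n = f n'"
  shows "\<exists>r :: nat \<Rightarrow> nat. strict_mono r \<and>
    (\<forall>n n'. strict_mono n \<longrightarrow> strict_mono n' \<longrightarrow> f (r \<circ> n) = f (r \<circ> n'))"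
proof -
  define g where "g = (\<lambda>X. f (\<lambda>i. if i < k then sorted_list_of_set X ! i else 0))"
  have "\<exists>Y t. Y \<subseteq> UNIV \<and> infinite Y \<and> t < s \<and>
      (\<forall>X. X \<subseteq> Y \<and> finite X \<and> card X = k \<longrightarrow> g X = t)"
    by (rule Ramsey) (auto simp: g_def bdd)
  then obtain Y t where Y: "infinite Y" and g: "\<forall>X. X \<subseteq> Y \<and> finite X \<and> card X = k \<longrightarrow> g X = t"
    by (elim exE conjE)
  have "f (enumerate Y \<circ> n) = t" if n: "strict_mono n" for n
  proof -
    let ?m = "enumerate Y \<circ> n"
    have m: "strict_mono ?m"
      by (rule strict_mono_o[OF strict_mono_enumerate[OF Y] n])
    have "sorted_list_of_set (?m ` {..<k}) = map ?m [0..<k]"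
    proof -
      have "sorted_wrt (<) (map ?m [0..<k])"
        using m by (auto simp: sorted_wrt_iff_nth_less strict_mono_def)
      then have "sorted_list_of_set (set (map ?m [0..<k])) = map ?m [0..<k]"
        by (simp only: sorted_list_of_set.idem_if_sorted_distinct strict_sorted_iff)
      then show ?thesis by (simp add: atLeast0LessThan)
    qed
    then have "f ?m = g (?m ` {..<k})"
      unfolding g_def by (intro dep) simp
    also have "\<dots> = t"
    proof (rule g[rule_format], intro conjI)
      show "?m ` {..<k} \<subseteq> Y" using enumerate_in_set[OF Y] by auto
      show "card (?m ` {..<k}) = k"
        using card_image[OF strict_mono_imp_inj_on[OF m], of "{..<k}"] by simp
    qed simp
    finally show ?thesis .
  qed
  then show ?thesis by (intro exI[of _ "enumerate Y"]) (simp add: strict_mono_enumerate[OF Y])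
qed

text \<open>The colour is the number of the interval of length \<open>e\<close> that contains
  \<open>f n + B\<close>. Adding \<open>B\<close> makes this number nonnegative, so
  \<open>nat\<close> loses nothing, and \<open>2 * B / e\<close> bounds it. Values in one half-open
  interval differ by less than \<open>e\<close>.\<close>

lemma ramsey_real_strict_mono:
  fixes f :: "(nat \<Rightarrow> nat) \<Rightarrow> real"
  assumes bdd: "\<And>n. \<bar>f n\<bar> \<le> B" and e: "e > 0"
    and dep: "\<And>n n'. (\<And>i. i < k \<Longrightarrow> n i = n' i) \<Longrightarrow> f n = f n'"
  shows "\<exists>r :: nat \<Rightarrow> nat. strict_mono r \<and>
    (\<forall>n n'. strict_mono n \<longrightarrow> strict_mono n' \<longrightarrow> \<bar>f (r \<circ> n) - f (r \<circ> n')\<bar> < e)"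
proof -
  let ?g = "\<lambda>n. nat \<lfloor>(f n + B) / e\<rfloor>"
  have nonneg: "0 \<le> (f n + B) / e" for n
    using bdd[of n] e by (simp add: abs_le_iff)
  have "?g n < Suc (nat \<lfloor>2 * B / e\<rfloor>)" for n
    using bdd[of n] e by (intro le_imp_less_Suc nat_mono floor_mono divide_right_mono) auto
  then obtain r :: "nat \<Rightarrow> nat" where r: "strict_mono r"
    "\<And>n n'. strict_mono n \<Longrightarrow> strict_mono n' \<Longrightarrow> ?g (r \<circ> n) = ?g (r \<circ> n')"
    using ramsey_strict_mono[of ?g "Suc (nat \<lfloor>2 * B / e\<rfloor>)" k] dep by metis
  have "\<bar>f (r \<circ> n) - f (r \<circ> n')\<bar> < e" if "strict_mono n" "strict_mono n'" for n n'
  proof -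
    have "\<lfloor>(f (r \<circ> n) + B) / e\<rfloor> = \<lfloor>(f (r \<circ> n') + B) / e\<rfloor>"
      using r(2)[OF that] nonneg by (metis eq_nat_nat_iff zero_le_floor)
    then have "\<bar>(f (r \<circ> n) + B) / e - (f (r \<circ> n') + B) / e\<bar> < 1"
      by linarith
    then have "\<bar>f (r \<circ> n) - f (r \<circ> n')\<bar> / e < 1"
      using e by (simp add: abs_divide flip: diff_divide_distrib)
    then show ?thesis using e by simp
  qed
  with r(1) show ?thesis by blast
qed

text \<open>A Cauchy criterion for the filter. The limit is found along the sequences of consecutive
  indices \<open>(+) j\<close>, which start at \<open>j\<close>; small oscillation carries it to all
  increasing sequences.\<close>

lemma spread_filter_tendstoI:
  fixes f :: "(nat \<Rightarrow> nat) \<Rightarrow> real"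
  assumes osc: "\<And>e. e > 0 \<Longrightarrow> \<exists>N. \<forall>n n'. strict_mono n \<and> strict_mono n' \<and> N \<le> n 0 \<and> N \<le> n' 0
      \<longrightarrow> \<bar>f n - f n'\<bar> < e"
  shows "\<exists>l. (f \<longlongrightarrow> l) spread_filter"
proof -
  have sm: "strict_mono ((+) j)" for j :: nat by (simp add: strict_mono_def)
  have "Cauchy (\<lambda>j. f ((+) j))"
    unfolding Cauchy_def dist_real_def
    using osc sm by (metis add.right_neutral)
  then obtain l where l: "(\<lambda>j. f ((+) j)) \<longlonglongrightarrow> l"
    by (auto simp: Cauchy_convergent_iff convergent_def)
  have "(f \<longlongrightarrow> l) spread_filter"
  proof (rule tendstoI)
    fix e :: real assume "e > 0"
    then obtain N where N: "\<And>n n'. strict_mono n \<Longrightarrow> strict_mono n' \<Longrightarrow> N \<le> n 0 \<Longrightarrow> N \<le> n' 0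
      \<Longrightarrow> \<bar>f n - f n'\<bar> < e / 2"
      using osc[of "e / 2"] by auto
    have "\<bar>f n - l\<bar> \<le> e / 2" if "strict_mono n" "N \<le> n 0" for n
    proof (rule LIMSEQ_le_const2[OF tendsto_rabs[OF tendsto_diff[OF tendsto_const l]]])
      show "\<exists>M. \<forall>j\<ge>M. \<bar>f n - f ((+) j)\<bar> \<le> e / 2"
        using N[OF that(1) sm that(2)] by (intro exI[of _ N]) (auto intro: less_imp_le)
    qed
    then have "dist (f n) l < e" if "strict_mono n" "N \<le> n 0" for n
      using that \<open>e > 0\<close> by (fastforce simp: dist_real_def)
    then show "eventually (\<lambda>n. dist (f n) l < e) spread_filter"
      unfolding eventually_spread_filter by blast
  qed
  then show ?thesis ..
qed

text \<open>Allows real coefficients to be replaced by rational ones, with an error that is uniform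
  in the indices \<open>n\<close>.\<close>

lemma norm_comb_diff_le:
  fixes x :: "nat \<Rightarrow> 'a::real_normed_vector"
  assumes B: "\<And>k. norm (x k) \<le> B" and ab: "\<And>i. i < k \<Longrightarrow> \<bar>a i - b i\<bar> \<le> d"
  shows "\<bar>norm (\<Sum>i<k. a i *\<^sub>R x (n i)) - norm (\<Sum>i<k. b i *\<^sub>R x (n i))\<bar> \<le> real k * (d * B)"
proof -
  have "\<bar>norm (\<Sum>i<k. a i *\<^sub>R x (n i)) - norm (\<Sum>i<k. b i *\<^sub>R x (n i))\<bar>
      \<le> norm (\<Sum>i<k. (a i - b i) *\<^sub>R x (n i))"
    using norm_triangle_ineq3[of "\<Sum>i<k. a i *\<^sub>R x (n i)" "\<Sum>i<k. b i *\<^sub>R x (n i)"]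
    by (simp add: scaleR_diff_left sum_subtractf)
  also have "\<dots> \<le> (\<Sum>i<k. d * B)"
    using B ab by (intro sum_norm_le) (auto intro!: mult_mono order_trans[OF abs_ge_zero ab])
  finally show ?thesis by simp
qed

text \<open>Brunel-Sucheston: Ramsey's theorem stabilises the norm of one combination up to a given
  precision; diagonalise over all rational combinations and precisions.\<close>

lemma ex_good_subseq:
  fixes x :: "nat \<Rightarrow> 'a::real_normed_vector"
  assumes "bounded (range x)"
  shows "\<exists>\<phi>. strict_mono \<phi> \<and> good_seq (x \<circ> \<phi>)"
proof -
  obtain B where B0: "B > 0" and B: "\<And>k. norm (x k) \<le> B"
    using assms by (auto simp: bounded_pos)
  define F where "F = (\<lambda>(q :: rat list) n. norm (\<Sum>i<length q. of_rat (q ! i) *\<^sub>R x (n i)))"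
  \<comment> \<open>Rational lists with a precision are countable, so \<open>j\<close> can encode
    such a pair. The quantification over all increasing \<open>n\<close> makes the property pass to
    subsequences.\<close>
  define P where "P = (\<lambda>j (s :: nat \<Rightarrow> nat). \<forall>n n' :: nat \<Rightarrow> nat. strict_mono n \<longrightarrow> strict_mono n' \<longrightarrow>
    (case from_nat j of (q, m) \<Rightarrow> \<bar>F q (s \<circ> n) - F q (s \<circ> n')\<bar> < 1 / real (Suc m)))"
  have PD: "case from_nat j of (q, m) \<Rightarrow> \<bar>F q (s \<circ> n) - F q (s \<circ> n')\<bar> < 1 / real (Suc m)"
    if "P j s" "strict_mono n" "strict_mono n'" for j s n n'
    by (rule that(1)[unfolded P_def, rule_format, OF that(2,3)])
  interpret subseqs P
  proof
    fix j and s :: "nat \<Rightarrow> nat" assume "strict_mono s"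
    obtain q m where j: "from_nat j = (q :: rat list, m :: nat)" by fastforce
    have "\<bar>F q (s \<circ> n)\<bar> \<le> (\<Sum>i<length q. \<bar>of_rat (q ! i)\<bar> * B)" for n
      unfolding F_def using B by (auto intro!: sum_norm_le mult_left_mono)
    then have "\<exists>r :: nat \<Rightarrow> nat. strict_mono r \<and> (\<forall>n n'. strict_mono n \<longrightarrow> strict_mono n' \<longrightarrow>
        \<bar>F q (s \<circ> (r \<circ> n)) - F q (s \<circ> (r \<circ> n'))\<bar> < 1 / real (Suc m))"
      by (rule ramsey_real_strict_mono[where k = "length q"]) (auto simp: F_def intro!: arg_cong[of _ _ norm] sum.cong)
    then show "\<exists>r. strict_mono r \<and> P j (s \<circ> r)"
      unfolding P_def j prod.case comp_assoc .
  qed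
  \<comment> \<open>The diagonal sequence refines the \<open>j\<close>-th choice only from position
    \<open>Suc j\<close> on.\<close>
  have tail: "P j (diagseq \<circ> (+) (Suc j))" for j
  proof (rule diagseq_holds)
    fix r s :: "nat \<Rightarrow> nat" and j assume r: "strict_mono r" and P: "P j s"
    show "P j (s \<circ> r)"
      unfolding P_def comp_assoc
      by (intro allI impI PD[OF P] strict_mono_o[OF r])
  qed
  have "good_seq (x \<circ> diagseq)"
    unfolding good_seq_def
  proof (intro allI spread_filter_tendstoI)
    fix k and a :: "nat \<Rightarrow> real" and e :: real assume e: "e > 0"
    \<comment> \<open>The factor \<open>k + 1\<close> in place of \<open>k\<close> keeps
      \<open>D\<close> positive for the empty combination. With \<open>d = e / 4 / D\<close> the
      rational approximation costs at most \<open>e / 4\<close>; it is used twice, and the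
      oscillation adds less than \<open>e / 4\<close>.\<close>
    define D where "D = (real k + 1) * B"
    have D: "D > 0" unfolding D_def using B0 by (intro mult_pos_pos) auto
    define d where "d = e / 4 / D"
    have d: "d > 0" using e D by (simp add: d_def)
    have "real k * (d * B) \<le> d * D" using d B0 by (simp add: D_def algebra_simps)
    also have "\<dots> = e / 4" using D by (simp add: d_def)
    finally have small: "real k * (d * B) \<le> e / 4" .
    have "\<exists>q. \<bar>a i - of_rat q\<bar> \<le> d" for i
    proof -
      obtain q where "a i - d < of_rat q" "of_rat q < a i"
        using of_rat_dense[of "a i - d" "a i"] d by auto
      then show ?thesis by (intro exI[of _ q]) linarith
    qed
    then obtain b where b: "\<And>i. \<bar>a i - of_rat (b i)\<bar> \<le> d" by metis
    define q where "q = map b [0..<k]"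
    obtain m where m: "1 / real (Suc m) < e / 4"
      using reals_Archimedean[of "e / 4"] e by (auto simp: inverse_eq_divide)
    define j where "j = to_nat (q, m)"
    let ?f = "\<lambda>n. norm (\<Sum>i<k. a i *\<^sub>R (x \<circ> diagseq) (n i))"
    have near: "\<bar>?f n - F q (diagseq \<circ> n)\<bar> \<le> e / 4" for n
    proof -
      have "F q (diagseq \<circ> n) = norm (\<Sum>i<k. of_rat (b i) *\<^sub>R (x \<circ> diagseq) (n i))"
        by (simp add: F_def q_def)
      also have "\<bar>?f n - \<dots>\<bar> \<le> real k * (d * B)"
        using B b by (intro norm_comb_diff_le) auto
      finally show ?thesis using small by linarith
    qed
    have "\<bar>?f n - ?f n'\<bar> < e"
      if n: "strict_mono n" "strict_mono n'" "Suc j \<le> n 0" "Suc j \<le> n' 0" for n n'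
    proof -
      have tail_q: "\<bar>F q ((diagseq \<circ> (+) (Suc j)) \<circ> n) - F q ((diagseq \<circ> (+) (Suc j)) \<circ> n')\<bar> < 1 / real (Suc m)"
        if "strict_mono n" "strict_mono n'" for n n' :: "nat \<Rightarrow> nat"
        using PD[OF tail[of j] that] unfolding j_def from_nat_to_nat prod.case .
      \<comment> \<open>The property of the tail applies to indices counted from
        \<open>Suc j\<close>. Every entry of \<open>n\<close> is at least \<open>Suc j\<close>, so
        truncated subtraction is exact here and preserves strict growth.\<close>
      have down: "strict_mono (\<lambda>i. n i - Suc j)" "(diagseq \<circ> (+) (Suc j)) \<circ> (\<lambda>i. n i - Suc j) = diagseq \<circ> n"
        if n: "strict_mono n" "Suc j \<le> n 0" for n :: "nat \<Rightarrow> nat"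
      proof -
        have le: "Suc j \<le> n i" for i
          using n(2) strict_mono_less_eq[OF n(1), of 0 i] by simp
        show "strict_mono (\<lambda>i. n i - Suc j)"
          by (intro strict_monoI diff_less_mono strict_monoD[OF n(1)] le)
        show "(diagseq \<circ> (+) (Suc j)) \<circ> (\<lambda>i. n i - Suc j) = diagseq \<circ> n"
          unfolding fun_eq_iff comp_apply le_add_diff_inverse[OF le] by simp
      qed
      have "\<bar>F q (diagseq \<circ> n) - F q (diagseq \<circ> n')\<bar> < 1 / real (Suc m)"
        using tail_q[OF down(1)[OF n(1,3)] down(1)[OF n(2,4)]]
        unfolding down(2)[OF n(1,3)] down(2)[OF n(2,4)] .
      with near[of n] near[of n'] m show ?thesis by linarith
    qed
    then show "\<exists>N. \<forall>n n'. strict_mono n \<and> strict_mono n' \<and> N \<le> n 0 \<and> N \<le> n' 0 \<longrightarrow> \<bar>?f n - ?f n'\<bar> < e"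
      by blast
  qed
  with subseq_diagseq show ?thesis by blast
qed

theorem theorem6p3:
  assumes "\<forall>Z \<in> spreading_models TYPE('a::banach). fpp_affine_isometries Z"
  shows "Banach_Saks TYPE('a)"
  unfolding Banach_Saks_def
proof (intro allI impI)
  fix x :: "nat \<Rightarrow> 'a" assume x: "bounded (range x)"
  obtain \<phi> where \<phi>: "strict_mono \<phi>" "good_seq (x \<circ> \<phi>)"
    using ex_good_subseq[OF x] by blast
  have bdd: "bounded (range (x \<circ> \<phi>))"
    by (rule bounded_subset[OF x]) auto
  have "convergent (\<lambda>n. (1 / real n) *\<^sub>R (\<Sum>k<n. (x \<circ> \<phi>) k))"
  proof (cases "convergent (x \<circ> \<phi>)")
    case True
    then show ?thesis by (rule cesaro_convergent_of_convergent)
  next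
    case False
    then have "ns_completion (spreading_norm (x \<circ> \<phi>)) \<in> spreading_models TYPE('a)"
      unfolding spreading_models_def using bdd \<phi>(2) by blast
    with assms show ?thesis
      by (intro cesaro_convergent_of_fpp[OF bdd \<phi>(2)]) blast
  qed
  with \<phi>(1) show "\<exists>\<phi>. strict_mono \<phi> \<and> convergent (\<lambda>n. (1 / real n) *\<^sub>R (\<Sum>k<n. x (\<phi> k)))"
    by (intro exI[of _ \<phi>]) simp
qed

end
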